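(* Let $q$ be a complex number with $|q|<1$. Define sequences $(A_m)_{m\ge 0}$ and $(B_m)_{m\ge 0}$ by $$A_m=-q^{2m-3}A_{m-1}+A_{m-2}\quad(m\ge 2),\qquad A_0=1,\ A_1=0,$$ $$B_m=-q^{2m-3}B_{m-1}+B_{m-2}\quad(m\ge 2),\qquad B_0=0,\ B_1=1.$$ Then for every integer $m\ge 0$, $$\sum_{n=0}^{\infty}\frac{q^{n^2+2mn}}{(q^4;q^4)_n}=\frac{A_m}{(q,q^4;q^5)_{\infty}(-q^2;q^2)_{\infty}}+\frac{B_m}{(q^2,q^3;q^5)_{\infty}(-q^2;q^2)_{\infty}}.$$
   Context: For $|p|<1$, $(a;p)_\infty=\prod_{k=0}^{\infty}(1-ap^k)$ and, for an integer $n\ge 0$, $(a;p)_n=\prod_{k=0}^{n-1}(1-ap^k)$. Multiple $q$-shifted factorials are products: $(a_1,\dots,a_r;p)_\infty=(a_1;p)_\infty\cdots(a_r;p)_\infty$. *)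

theory Defs
  imports "HOL-Analysis.Analysis"
begin

definition qpoch :: "complex \<Rightarrow> complex \<Rightarrow> nat \<Rightarrow> complex" where
  "qpoch a p n = (\<Prod>k<n. 1 - a * p ^ k)"

text \<open>Only meaningful for \<open>norm p < 1\<close>, where the product converges.\<close>
definition qpoch_inf :: "complex \<Rightarrow> complex \<Rightarrow> complex" where
  "qpoch_inf a p = prodinf (\<lambda>k. 1 - a * p ^ k)"

definition qpochs_inf :: "complex list \<Rightarrow> complex \<Rightarrow> complex" where
  "qpochs_inf as p = (\<Prod>a\<leftarrow>as. qpoch_inf a p)"

end

theory Submission
  imports Defs
begin

text \<open>
  Write \<open>S m\<close> for the series. Comparing coefficients gives \<open>S (m + 2) = S m - q ^ (2 * m + 1) * S (m + 1)\<close>,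
  the recurrence of \<open>A\<close> and \<open>B\<close>, so only \<open>m = 0\<close> and \<open>m = 1\<close> remain. Since
  \<open>(q\<^sup>4; q\<^sup>4)\<^sub>n = (q\<^sup>2; q\<^sup>2)\<^sub>n (-q\<^sup>2; q\<^sup>2)\<^sub>n\<close>, multiplying \<open>S m\<close> by \<open>(-q\<^sup>2; q\<^sup>2)\<^sub>\<infinity>\<close>, expanding the tail
  product by Euler's formula and summing the double series along diagonals turns \<open>S 0\<close> and \<open>S 1\<close>
  into the two Rogers--Ramanujan series. These are evaluated by two applications of
  Bailey's lemma to a unit Bailey pair, followed by the Jacobi triple product.
\<close>

subsection \<open>Shifted factorials\<close>

lemma qpoch_0 [simp]: "qpoch a p 0 = 1"
  by (simp add: qpoch_def)

lemma qpoch_Suc: "qpoch a p (Suc n) = qpoch a p n * (1 - a * p ^ n)"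
  by (simp add: qpoch_def)

lemma qpoch_Suc_shift: "qpoch a p (Suc n) = (1 - a) * qpoch (a * p) p n"
  unfolding qpoch_def by (subst prod.lessThan_Suc_shift) (simp add: mult.assoc)

lemma one_minus_power_nonzero:
  fixes p :: complex
  assumes "norm p < 1" "n > 0"
  shows "1 - p ^ n \<noteq> 0"
proof
  assume "1 - p ^ n = 0"
  then have "norm p ^ n = 1"
    by (metis eq_iff_diff_eq_0 norm_one norm_power)
  moreover have "norm p ^ n < 1"
    using assms by (simp add: power_less_one_iff)
  ultimately show False by simp
qed

lemma qpoch_self_nonzero:
  assumes "norm p < 1"
  shows "qpoch p p n \<noteq> 0"
  using one_minus_power_nonzero[OF assms, of "Suc _"] by (auto simp: qpoch_def)

lemma convergent_prod_qpoch:
  fixes a p :: complex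
  assumes "norm p < 1"
  shows "convergent_prod (\<lambda>k. 1 - a * p ^ k)"
proof -
  have "summable (\<lambda>k. norm a * norm p ^ k)"
    using assms by (intro summable_mult summable_geometric) simp
  moreover have "norm ((1 - a * p ^ k) - 1) = norm a * norm p ^ k" for k
    by (simp add: norm_mult norm_power)
  ultimately have "summable (\<lambda>k. norm ((1 - a * p ^ k) - 1))"
    by (simp only:)
  then have "abs_convergent_prod (\<lambda>k. 1 - a * p ^ k)"
    unfolding abs_convergent_prod_conv_summable .
  then show ?thesis
    by (rule abs_convergent_prod_imp_convergent_prod)
qed

lemma qpoch_tendsto:
  assumes "norm p < 1"
  shows "qpoch a p \<longlonglongrightarrow> qpoch_inf a p"
  using convergent_prod_LIMSEQ[OF convergent_prod_qpoch[OF assms, of a]]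
  unfolding qpoch_def qpoch_inf_def by (simp add: LIMSEQ_lessThan_iff_atMost)

lemma qpoch_inf_nonzero:
  assumes "norm p < 1" "\<And>k. a * p ^ k \<noteq> 1"
  shows "qpoch_inf a p \<noteq> 0"
  unfolding qpoch_inf_def using assms
  by (intro prodinf_nonzero convergent_prod_qpoch) auto

lemma qpoch_inf_nonzero':
  assumes "norm p < 1" "norm a < 1"
  shows "qpoch_inf a p \<noteq> 0"
proof (rule qpoch_inf_nonzero[OF assms(1)])
  fix k
  have "norm (a * p ^ k) \<le> norm a * 1"
    unfolding norm_mult norm_power using assms
    by (intro mult_left_mono power_le_one) auto
  then show "a * p ^ k \<noteq> 1" using assms(2) by auto
qed

lemma qpoch_inf_split:
  assumes "norm p < 1"
  shows "qpoch_inf a p = qpoch a p n * qpoch_inf (a * p ^ n) p"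
proof (rule LIMSEQ_unique)
  have "qpoch a p (n + k) = qpoch a p n * qpoch (a * p ^ n) p k" for k
    by (induction k) (simp_all add: qpoch_Suc power_add mult_ac)
  then show "(\<lambda>k. qpoch a p (k + n)) \<longlonglongrightarrow> qpoch a p n * qpoch_inf (a * p ^ n) p"
    by (simp add: add.commute[of _ n] tendsto_mult_left qpoch_tendsto[OF assms])
  show "(\<lambda>k. qpoch a p (k + n)) \<longlonglongrightarrow> qpoch_inf a p"
    by (rule LIMSEQ_ignore_initial_segment[OF qpoch_tendsto[OF assms]])
qed

text \<open>The exponents are sorted by residue modulo 5, and the limit is taken along multiples of
  5 so that every class is complete. This lets a triple product with base \<open>q ^ 5\<close>
  cancel against \<open>qpoch_inf q q\<close>.\<close>

lemma qpoch_inf_dissect: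
  assumes "norm q < 1"
  shows "qpoch_inf q q = qpoch_inf q (q ^ 5) * qpoch_inf (q ^ 2) (q ^ 5) * qpoch_inf (q ^ 3) (q ^ 5)
    * qpoch_inf (q ^ 4) (q ^ 5) * qpoch_inf (q ^ 5) (q ^ 5)" (is "_ = ?R")
proof (rule LIMSEQ_unique)
  have q5: "norm (q ^ 5) < 1"
    using assms by (simp add: norm_power power_less_one_iff)
  have "qpoch q q (5 * n) = qpoch q (q ^ 5) n * qpoch (q ^ 2) (q ^ 5) n * qpoch (q ^ 3) (q ^ 5) n
    * qpoch (q ^ 4) (q ^ 5) n * qpoch (q ^ 5) (q ^ 5) n" for n
  proof (induction n)
    case (Suc n)
    have "5 * Suc n = Suc (Suc (Suc (Suc (Suc (5 * n)))))" by simp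
    then have "qpoch q q (5 * Suc n) = qpoch q q (5 * n) * (1 - q * q ^ (5 * n))
      * (1 - q ^ 2 * q ^ (5 * n)) * (1 - q ^ 3 * q ^ (5 * n)) * (1 - q ^ 4 * q ^ (5 * n))
      * (1 - q ^ 5 * q ^ (5 * n))"
      by (simp add: qpoch_Suc numeral_eq_Suc mult_ac)
    then show ?case
      unfolding Suc qpoch_Suc power_mult[symmetric] by (simp only: mult_ac)
  qed simp
  then show "(\<lambda>n. qpoch q q (5 * n)) \<longlonglongrightarrow> ?R"
    by (simp add: tendsto_mult qpoch_tendsto[OF q5])
  show "(\<lambda>n. qpoch q q (5 * n)) \<longlonglongrightarrow> qpoch_inf q q"
    using LIMSEQ_subseq_LIMSEQ[OF qpoch_tendsto[OF assms], of "\<lambda>n. 5 * n"]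
    by (simp add: strict_mono_def o_def)
qed

text \<open>Gaussian binomials become \<open>rq p k * rq p (N - k) / rq p N\<close>, so finite
  identities are plain convolutions whose limits in \<open>N\<close> are easy to read off.\<close>

definition rq :: "complex \<Rightarrow> nat \<Rightarrow> complex" where
  "rq p n = inverse (qpoch p p n)"

lemma rq_0 [simp]: "rq p 0 = 1"
  by (simp add: rq_def)

lemma rq_Suc:
  assumes "norm p < 1"
  shows "(1 - p ^ Suc n) * rq p (Suc n) = rq p n"
  using qpoch_self_nonzero[OF assms, of "Suc n"]
  by (auto simp: rq_def qpoch_Suc field_simps)

lemma rq_tendsto:
  assumes "norm p < 1"
  shows "rq p \<longlonglongrightarrow> inverse (qpoch_inf p p)"
  unfolding rq_def
  by (intro tendsto_inverse qpoch_tendsto qpoch_inf_nonzero' assms)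

lemma rq_bounded:
  assumes "norm p < 1"
  obtains K where "K > 0" "\<And>n. norm (rq p n) \<le> K"
proof -
  have "Bseq (rq p)"
    by (rule convergent_imp_Bseq) (use rq_tendsto[OF assms] in \<open>auto simp: convergent_def\<close>)
  then show ?thesis using that by (auto elim: BseqE)
qed

section \<open>Limits under the sum sign: Tannery's theorem\<close>

lemma tendsto_suminf_dominated:
  fixes f :: "nat \<Rightarrow> nat \<Rightarrow> complex"
  assumes "\<And>k. (\<lambda>n. f n k) \<longlonglongrightarrow> g k" "\<And>n k. norm (f n k) \<le> M k" "summable M"
  shows "(\<lambda>n. \<Sum>k. f n k) \<longlonglongrightarrow> (\<Sum>k. g k)"
proof -
  have u: "uniform_limit UNIV (\<lambda>K n. \<Sum>k<K. f n k) (\<lambda>n. \<Sum>k. f n k) sequentially"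
    using assms by (intro Weierstrass_m_test[where M = M]) auto
  have g: "norm (g k) \<le> M k" for k
    by (rule Lim_bounded[OF tendsto_norm[OF assms(1)], of 0]) (use assms(2) in auto)
  have "summable g"
    by (rule summable_comparison_test'[OF assms(3), of 0]) (use g in auto)
  then have "(\<lambda>K. \<Sum>k<K. g k) \<longlonglongrightarrow> (\<Sum>k. g k)"
    by (rule summable_LIMSEQ)
  then show ?thesis
    by (intro swap_uniform_limit'[OF _ _ u]) (auto intro!: always_eventually tendsto_sum assms(1))
qed

text \<open>Padding with zeros above \<open>n\<close> reduces the growing range to a full series;
  any fixed \<open>k\<close> is eventually within range.\<close>

lemma tendsto_sum_dominated:
  fixes f :: "nat \<Rightarrow> nat \<Rightarrow> complex"
  assumes "\<And>k. (\<lambda>n. f n k) \<longlonglongrightarrow> g k" "\<And>n k. norm (f n k) \<le> M k" "summable M"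
  shows "(\<lambda>n. \<Sum>k\<le>n. f n k) \<longlonglongrightarrow> (\<Sum>k. g k)"
proof -
  let ?f = "\<lambda>n k. if k \<le> n then f n k else 0"
  have M: "0 \<le> M k" for k
    using assms(2)[of 0 k] norm_ge_zero order_trans by blast
  have "(\<lambda>n. \<Sum>k. ?f n k) \<longlonglongrightarrow> (\<Sum>k. g k)"
  proof (rule tendsto_suminf_dominated[OF _ _ assms(3)])
    fix k
    have "eventually (\<lambda>n. ?f n k = f n k) sequentially"
      using eventually_ge_at_top[of k] by eventually_elim simp
    then show "(\<lambda>n. ?f n k) \<longlonglongrightarrow> g k"
      using assms(1)[of k] by (simp add: tendsto_cong)
  qed (use assms(2) M in auto)
  moreover have "(\<Sum>k. ?f n k) = (\<Sum>k\<le>n. f n k)" for n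
    by (subst suminf_finite[of "{..n}"]) auto
  ultimately show ?thesis by simp
qed

subsection \<open>Finite q-identities\<close>

text \<open>Pascal's rule for Gaussian binomial coefficients, divided by \<open>(p; p)\<^sub>N\<close>.\<close>

lemma rq_pascal:
  fixes f :: "nat \<Rightarrow> complex"
  assumes "norm p < 1"
  shows "(1 - p ^ Suc N) * (\<Sum>k\<le>Suc N. f k * rq p k * rq p (Suc N - k))
    = (\<Sum>k\<le>N. (f (Suc k) + p ^ k * f k) * rq p k * rq p (N - k))"
proof -
  let ?t = "\<lambda>k. f k * rq p k * rq p (Suc N - k)"
  \<comment> \<open>Splits \<open>1 - p ^ Suc N\<close> as
    \<open>(1 - p ^ k) + p ^ k * (1 - p ^ (Suc N - k))\<close>; each piece lowers the index of one
    \<open>rq\<close> factor.\<close>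
  have "(1 - p ^ Suc N) * (\<Sum>k\<le>Suc N. ?t k)
    = (\<Sum>k\<le>Suc N. (1 - p ^ k) * ?t k + p ^ k * (1 - p ^ (Suc N - k)) * ?t k)"
    unfolding sum_distrib_left
    by (intro sum.cong refl) (simp add: algebra_simps flip: power_add power_Suc)
  also have "\<dots> = (\<Sum>k\<le>Suc N. (1 - p ^ k) * ?t k) + (\<Sum>k\<le>Suc N. p ^ k * (1 - p ^ (Suc N - k)) * ?t k)"
    by (rule sum.distrib)
  also have "(\<Sum>k\<le>Suc N. (1 - p ^ k) * ?t k) = (\<Sum>k\<le>N. f (Suc k) * ((1 - p ^ Suc k) * rq p (Suc k)) * rq p (N - k))"
    by (subst sum.atMost_Suc_shift) (simp add: mult_ac)
  also have "(\<Sum>k\<le>Suc N. p ^ k * (1 - p ^ (Suc N - k)) * ?t k)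
    = (\<Sum>k\<le>N. p ^ k * f k * rq p k * ((1 - p ^ Suc (N - k)) * rq p (Suc (N - k))))"
    by (simp add: Suc_diff_le mult_ac)
  finally show ?thesis
    unfolding rq_Suc[OF assms] by (simp only: distrib_right sum.distrib)
qed

text \<open>Closing move of the inductions built on \<open>rq_pascal\<close>: the factor
  \<open>1 - p ^ Suc n\<close> is nonzero and cancels.\<close>

lemma rq_Suc_cancel:
  assumes "norm p < 1" "(1 - p ^ Suc n) * x = rq p n * y"
  shows "x = rq p (Suc n) * y"
proof -
  have "(1 - p ^ Suc n) * x = (1 - p ^ Suc n) * (rq p (Suc n) * y)"
    using assms(2) rq_Suc[OF assms(1), of n] by (metis mult.assoc)
  then show ?thesis
    using one_minus_power_nonzero[OF assms(1), of "Suc n"] by (simp only: mult_cancel_left) blast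
qed

text \<open>Pascal's rule trades one unit of \<open>M\<close> for one unit of \<open>c\<close>,
  which is why the induction keeps \<open>c\<close> arbitrary.\<close>

lemma q_Vandermonde:
  assumes "norm p < 1"
  shows "(\<Sum>t\<le>M. p ^ (t * (t + c)) * rq p (t + c) * rq p t * rq p (M - t)) = rq p M * rq p (M + c)"
proof (induction M arbitrary: c)
  case 0
  show ?case by simp
next
  case (Suc M)
  have eq: "p ^ (Suc k * (Suc k + c)) * rq p (Suc k + c) + p ^ k * (p ^ (k * (k + c)) * rq p (k + c))
    = p ^ (k * (k + Suc c)) * rq p (k + Suc c)" for k
    unfolding rq_Suc[OF assms, of "k + c", symmetric] by (simp add: algebra_simps power_add)
  have "(1 - p ^ Suc M) * (\<Sum>t\<le>Suc M. p ^ (t * (t + c)) * rq p (t + c) * rq p t * rq p (Suc M - t))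
    = rq p M * rq p (M + Suc c)"
    unfolding rq_pascal[OF assms, of M "\<lambda>t. p ^ (t * (t + c)) * rq p (t + c)"] eq by (rule Suc)
  from rq_Suc_cancel[OF assms this] show ?case
    by (simp only: add_Suc_shift)
qed

text \<open>Pascal's rule extracts the first factor \<open>1 - z\<close> and replaces
  \<open>z\<close> by \<open>z * p\<close>, hence the induction over arbitrary
  \<open>z\<close>.\<close>

lemma q_binomial:
  assumes "norm p < 1"
  shows "(\<Sum>k\<le>N. (- z) ^ k * p ^ (k choose 2) * rq p k * rq p (N - k)) = rq p N * qpoch z p N"
proof (induction N arbitrary: z)
  case (Suc N)
  have eq: "(- z) ^ Suc k * p ^ (Suc k choose 2) + p ^ k * ((- z) ^ k * p ^ (k choose 2))
    = (1 - z) * ((- (z * p)) ^ k * p ^ (k choose 2))" for k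
  proof -
    have "(- (z * p)) ^ k = (- z) ^ k * p ^ k"
      by (simp flip: power_mult_distrib)
    then show ?thesis
      by (simp only:) (simp add: numeral_2_eq_2 power_add algebra_simps)
  qed
  have "(1 - p ^ Suc N) * (\<Sum>k\<le>Suc N. (- z) ^ k * p ^ (k choose 2) * rq p k * rq p (Suc N - k))
    = (1 - z) * (\<Sum>k\<le>N. (- (z * p)) ^ k * p ^ (k choose 2) * rq p k * rq p (N - k))"
    unfolding rq_pascal[OF assms] eq by (simp add: sum_distrib_left mult.assoc)
  also have "\<dots> = rq p N * qpoch z p (Suc N)"
    unfolding Suc by (simp add: qpoch_Suc_shift)
  finally show ?case
    by (rule rq_Suc_cancel[OF assms])
qed (simp add: numeral_2_eq_2)


text \<open>For fixed \<open>k\<close> each \<open>rq\<close> factor tends to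
  \<open>inverse (qpoch_inf p p)\<close>, and boundedness of \<open>rq\<close> gives the domination.
  The limits of Euler, Jacobi and Bailey below all use this.\<close>

lemma suminf_mult_rq_tendsto:
  fixes a :: "nat \<Rightarrow> complex"
  assumes "norm p < 1" "\<And>k. norm (a k) \<le> M k" "summable M"
  shows "(\<lambda>N. \<Sum>k\<le>N. a k * rq p (N - k)) \<longlonglongrightarrow> (\<Sum>k. a k) * inverse (qpoch_inf p p)"
    and "(\<lambda>N. \<Sum>k\<le>N. a k * rq p (N - k) * rq p (N + k + e))
      \<longlonglongrightarrow> (\<Sum>k. a k) * inverse (qpoch_inf p p) ^ 2"
proof -
  obtain K where K: "K > 0" "\<And>n. norm (rq p n) \<le> K"
    using rq_bounded[OF assms(1)] by blast
  let ?P = "inverse (qpoch_inf p p)"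
  have a: "summable a"
    using assms(2) by (intro summable_comparison_test'[OF assms(3), of 0])
  have l1: "(\<lambda>N. rq p (N - k)) \<longlonglongrightarrow> ?P" for k
    by (rule LIMSEQ_offset[of _ k]) (simp add: rq_tendsto[OF assms(1)])
  have l2: "(\<lambda>N. rq p (N + k + e)) \<longlonglongrightarrow> ?P" for k
    using LIMSEQ_ignore_initial_segment[OF rq_tendsto[OF assms(1)], of "k + e"] by (simp add: add.assoc)
  have M: "0 \<le> M k" for k
    using assms(2)[of k] norm_ge_zero order_trans by blast
  have "(\<lambda>N. \<Sum>k\<le>N. a k * rq p (N - k)) \<longlonglongrightarrow> (\<Sum>k. a k * ?P)"
  proof (rule tendsto_sum_dominated)
    show "norm (a k * rq p (n - k)) \<le> M k * K" for n k
      unfolding norm_mult by (intro mult_mono assms(2) K M norm_ge_zero)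
  qed (intro tendsto_intros l1 summable_mult2 assms)+
  then show "(\<lambda>N. \<Sum>k\<le>N. a k * rq p (N - k)) \<longlonglongrightarrow> (\<Sum>k. a k) * ?P"
    by (simp add: suminf_mult2[OF a])
  have "(\<lambda>N. \<Sum>k\<le>N. a k * rq p (N - k) * rq p (N + k + e)) \<longlonglongrightarrow> (\<Sum>k. a k * ?P * ?P)"
  proof (rule tendsto_sum_dominated)
    show "norm (a k * rq p (n - k) * rq p (n + k + e)) \<le> M k * K * K" for n k
      unfolding norm_mult using K(1) M by (intro mult_mono assms(2) K norm_ge_zero mult_nonneg_nonneg) auto
  qed (intro tendsto_intros l1 l2 summable_mult2 assms)+
  then show "(\<lambda>N. \<Sum>k\<le>N. a k * rq p (N - k) * rq p (N + k + e)) \<longlonglongrightarrow> (\<Sum>k. a k) * ?P ^ 2"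
    by (simp add: suminf_mult2[OF a] suminf_mult2[OF summable_mult2[OF a]] power2_eq_square mult.assoc)
qed

section \<open>Euler's expansion of an infinite product\<close>

lemma norm_mult_power_le:
  fixes x p :: complex
  assumes "norm p < 1"
  shows "norm (x * p ^ n) \<le> norm x"
  unfolding norm_mult norm_power using assms by (intro mult_left_le power_le_one) auto

text \<open>The limit of \<open>q_binomial\<close> as \<open>N\<close> grows; both sides carry
  \<open>inverse (qpoch_inf p p)\<close>, which cancels.\<close>

lemma Euler_qpoch_inf_sums:
  assumes "norm p < 1" "norm z < 1"
  shows "(\<lambda>k. (- z) ^ k * p ^ (k choose 2) * rq p k) sums qpoch_inf z p"
proof -
  obtain K where K: "K > 0" "\<And>n. norm (rq p n) \<le> K"
    using rq_bounded[OF assms(1)] by blast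
  let ?a = "\<lambda>k. (- z) ^ k * p ^ (k choose 2) * rq p k"
  have b: "norm (?a k) \<le> norm z ^ k * K" for k
  proof -
    have "norm ((- z) ^ k * p ^ (k choose 2)) \<le> norm z ^ k"
      using norm_mult_power_le[OF assms(1), of "(- z) ^ k"] by (simp add: norm_power)
    then show ?thesis
      unfolding norm_mult[of _ "rq p k"] by (intro mult_mono K) auto
  qed
  have s: "summable (\<lambda>k. norm z ^ k * K)"
    using assms(2) by (intro summable_mult2 summable_geometric) auto
  have "summable ?a"
    using b by (intro summable_comparison_test'[OF s, of 0])
  moreover have "(\<Sum>k. ?a k) = qpoch_inf z p"
  proof -
    have "(\<lambda>N. rq p N * qpoch z p N) \<longlonglongrightarrow> (\<Sum>k. ?a k) * inverse (qpoch_inf p p)"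
      using suminf_mult_rq_tendsto(1)[OF assms(1) b s] by (simp only: q_binomial[OF assms(1)])
    moreover have "(\<lambda>N. rq p N * qpoch z p N) \<longlonglongrightarrow> inverse (qpoch_inf p p) * qpoch_inf z p"
      by (intro tendsto_mult rq_tendsto qpoch_tendsto assms)
    ultimately have "(\<Sum>k. ?a k) * inverse (qpoch_inf p p) = inverse (qpoch_inf p p) * qpoch_inf z p"
      by (rule LIMSEQ_unique)
    then show ?thesis
      using qpoch_inf_nonzero'[OF assms(1,1)] by simp
  qed
  ultimately show ?thesis
    by (simp add: sums_iff)
qed

subsection \<open>The Jacobi triple product\<close>

text \<open>
  For \<open>z * w = p\<close> this is \<open>(-z) ^ j * p ^ (j (j - 1) / 2)\<close>; using \<open>w\<close> at negative \<open>j\<close> avoids dividing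
  by \<open>z\<close>, so that \<open>z = 0\<close> needs no separate treatment.
\<close>

definition jacobi_term :: "complex \<Rightarrow> complex \<Rightarrow> complex \<Rightarrow> int \<Rightarrow> complex" where
  "jacobi_term z w p j = (let i = nat \<bar>j\<bar> in (- (if j \<ge> 0 then z else w)) ^ i * p ^ (i choose 2))"

lemma jacobi_term_nonneg: "jacobi_term z w p (int i) = (- z) ^ i * p ^ (i choose 2)"
  by (simp add: jacobi_term_def)

lemma jacobi_term_nonpos: "jacobi_term z w p (- int i) = (- w) ^ i * p ^ (i choose 2)"
  by (cases "i = 0") (simp_all add: jacobi_term_def)

text \<open>On the \<open>w\<close> side neighbouring terms differ by a factor containing
  \<open>- w\<close>; on the \<open>z\<close> side the factor contains \<open>- z\<close>, and
  \<open>z * w = p\<close> turns the product with \<open>- w\<close> into a power of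
  \<open>p\<close>.\<close>

lemma jacobi_term_step:
  assumes "z * w = p"
  shows "p ^ k * jacobi_term z w p (int k - int (Suc m)) = - w * p ^ m * jacobi_term z w p (int k - int m)"
proof (cases "k \<le> m")
  case True
  then obtain i where m: "m = k + i"
    using le_Suc_ex by blast
  have "int k - int (Suc m) = - int (Suc i)" "int k - int m = - int i"
    using m by auto
  then show ?thesis
    by (simp only: jacobi_term_nonpos) (simp add: m numeral_2_eq_2 power_add)
next
  case False
  then obtain i where k: "k = Suc m + i"
    using le_Suc_ex[of "Suc m" k] by auto
  have "int k - int (Suc m) = int i" "int k - int m = int (Suc i)"
    using k by auto
  then show ?thesis
    by (simp only: jacobi_term_nonneg) (simp add: k numeral_2_eq_2 power_add flip: assms)
qed

text \<open>Induction on \<open>m\<close> alone, starting from \<open>q_binomial\<close>: raising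
  \<open>m\<close> shifts the centre of summation by one, and Pascal's rule extracts the new factor
  \<open>1 - w * p ^ m\<close>.\<close>

lemma finite_triple_product:
  assumes "norm p < 1" "z * w = p"
  shows "(\<Sum>k\<le>n + m. jacobi_term z w p (int k - int m) * rq p k * rq p (n + m - k))
    = rq p (n + m) * (qpoch z p n * qpoch w p m)"
proof (induction m)
  case 0
  show ?case
    using q_binomial[OF assms(1), where N = n and z = z] by (simp add: jacobi_term_nonneg)
next
  case (Suc m)
  have eq: "jacobi_term z w p (int (Suc k) - int (Suc m)) + p ^ k * jacobi_term z w p (int k - int (Suc m))
    = (1 - w * p ^ m) * jacobi_term z w p (int k - int m)" for k
    unfolding jacobi_term_step[OF assms(2)] by (simp add: algebra_simps)
  have "(1 - p ^ Suc (n + m)) * (\<Sum>k\<le>Suc (n + m). jacobi_term z w p (int k - int (Suc m)) * rq p k * rq p (Suc (n + m) - k))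
    = (1 - w * p ^ m) * (\<Sum>k\<le>n + m. jacobi_term z w p (int k - int m) * rq p k * rq p (n + m - k))"
    unfolding rq_pascal[OF assms(1)] eq by (simp add: sum_distrib_left mult.assoc)
  also have "\<dots> = rq p (n + m) * (qpoch z p n * qpoch w p (Suc m))"
    unfolding Suc by (simp add: qpoch_Suc)
  finally show ?case
    using rq_Suc_cancel[OF assms(1)] by (simp only: add_Suc_right)
qed

text \<open>Recentres at \<open>Suc n\<close>: the first sum collects the offsets \<open>r\<close>,
  the second the offsets \<open>- Suc r\<close>.\<close>

lemma sum_split_middle:
  fixes f :: "nat \<Rightarrow> complex"
  shows "(\<Sum>k\<le>Suc n + Suc n. f k) = (\<Sum>r\<le>Suc n. f (Suc n + r)) + (\<Sum>r\<le>n. f (n - r))"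
proof -
  have "{..Suc n + Suc n} = {..n} \<union> {Suc n..Suc n + Suc n}" by auto
  then have "(\<Sum>k\<le>Suc n + Suc n. f k) = (\<Sum>k\<le>n. f k) + (\<Sum>k=Suc n..Suc n + Suc n. f k)"
    by (simp only:) (subst sum.union_disjoint, auto)
  also have "(\<Sum>k\<le>n. f k) = (\<Sum>r\<le>n. f (n - r))"
    by (rule sum.reindex_bij_witness[of _ "\<lambda>r. n - r" "\<lambda>r. n - r"]) auto
  also have "(\<Sum>k=Suc n..Suc n + Suc n. f k) = (\<Sum>r\<le>Suc n. f (Suc n + r))"
    by (rule sum.reindex_bij_witness[of _ "\<lambda>r. Suc n + r" "\<lambda>k. k - Suc n"]) auto
  finally show ?thesis by (simp only: add.commute)
qed

text \<open>Limit of the finite identity with \<open>Suc n\<close> factors of either kind; the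
  bilateral series is kept as two series, over the indices \<open>r\<close> and
  \<open>- Suc r\<close>.\<close>

theorem Jacobi_triple_product:
  assumes "norm z < 1" "norm w < 1" "z * w = p"
  shows "summable (\<lambda>r. (- z) ^ r * p ^ (r choose 2))" "summable (\<lambda>r. (- w) ^ Suc r * p ^ (Suc r choose 2))"
    "(\<Sum>r. (- z) ^ r * p ^ (r choose 2)) + (\<Sum>r. (- w) ^ Suc r * p ^ (Suc r choose 2))
      = qpoch_inf z p * qpoch_inf w p * qpoch_inf p p"
proof -
  let ?u = "\<lambda>r. (- z) ^ r * p ^ (r choose 2)" and ?v = "\<lambda>r. (- w) ^ Suc r * p ^ (Suc r choose 2)"
  have p: "norm p < 1"
    unfolding assms(3)[symmetric] norm_mult using assms(1,2)
    by (metis mult_less_cancel_left2 norm_ge_zero less_le_trans mult_left_le less_imp_le order_le_less_trans)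
  have bu: "norm (?u r) \<le> norm z ^ r" for r
    using norm_mult_power_le[OF p, of "(- z) ^ r"] by (simp add: norm_power)
  have bv: "norm (?v r) \<le> norm w ^ Suc r" for r
    using norm_mult_power_le[OF p, of "(- w) ^ Suc r"] by (simp only: norm_power norm_minus_cancel)
  have su: "summable (\<lambda>r. norm z ^ r)" and sv: "summable (\<lambda>r. norm w ^ Suc r)"
    using assms by (auto intro!: summable_geometric summable_mult)
  show "summable ?u" by (rule summable_comparison_test'[OF su bu])
  show "summable ?v" by (rule summable_comparison_test'[OF sv bv])
  let ?P = "inverse (qpoch_inf p p)"
  let ?l = "\<lambda>n. rq p (Suc n + Suc n) * (qpoch z p (Suc n) * qpoch w p (Suc n))"
  \<comment> \<open>The trailing \<open>0\<close> here and \<open>2\<close> below are the shift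
    \<open>e\<close> of \<open>suminf_mult_rq_tendsto\<close>; the negative half runs at
    \<open>n\<close> instead of \<open>Suc n\<close>, hence the \<open>2\<close>.\<close>
  let ?r1 = "\<lambda>n. \<Sum>r\<le>n. ?u r * rq p (n - r) * rq p (n + r + 0)"
  let ?r2 = "\<lambda>n. \<Sum>r\<le>n. ?v r * rq p (n - r) * rq p (n + r + 2)"
  have eq: "?l n = ?r1 (Suc n) + ?r2 n" for n
  proof -
    have "?l n = (\<Sum>r\<le>Suc n. jacobi_term z w p (int (Suc n + r) - int (Suc n)) * rq p (Suc n + r) * rq p (Suc n + Suc n - (Suc n + r)))
      + (\<Sum>r\<le>n. jacobi_term z w p (int (n - r) - int (Suc n)) * rq p (n - r) * rq p (Suc n + Suc n - (n - r)))"
      unfolding finite_triple_product[OF p assms(3), symmetric] by (rule sum_split_middle)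
    also have "(\<Sum>r\<le>Suc n. jacobi_term z w p (int (Suc n + r) - int (Suc n)) * rq p (Suc n + r) * rq p (Suc n + Suc n - (Suc n + r))) = ?r1 (Suc n)"
    proof (rule sum.cong)
      fix r
      have "int (Suc n + r) - int (Suc n) = int r" "Suc n + Suc n - (Suc n + r) = Suc n - r" by auto
      then show "jacobi_term z w p (int (Suc n + r) - int (Suc n)) * rq p (Suc n + r) * rq p (Suc n + Suc n - (Suc n + r))
        = ?u r * rq p (Suc n - r) * rq p (Suc n + r + 0)"
        by (simp only: jacobi_term_nonneg) simp
    qed simp
    also have "(\<Sum>r\<le>n. jacobi_term z w p (int (n - r) - int (Suc n)) * rq p (n - r) * rq p (Suc n + Suc n - (n - r))) = ?r2 n"
    proof (rule sum.cong)
      fix r assume "r \<in> {..n}"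
      then have "int (n - r) - int (Suc n) = - int (Suc r)" "Suc n + Suc n - (n - r) = n + r + 2" by auto
      then show "jacobi_term z w p (int (n - r) - int (Suc n)) * rq p (n - r) * rq p (Suc n + Suc n - (n - r))
        = ?v r * rq p (n - r) * rq p (n + r + 2)"
        by (simp only: jacobi_term_nonpos)
    qed simp
    finally show ?thesis .
  qed
  have "(\<lambda>n. ?r1 (Suc n) + ?r2 n) \<longlonglongrightarrow> (\<Sum>r. ?u r) * ?P ^ 2 + (\<Sum>r. ?v r) * ?P ^ 2"
    by (intro tendsto_add LIMSEQ_Suc[of ?r1] suminf_mult_rq_tendsto(2)[OF p bu su]
        suminf_mult_rq_tendsto(2)[OF p bv sv])
  moreover have "(\<lambda>n. rq p (Suc n + Suc n)) \<longlonglongrightarrow> ?P"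
    using LIMSEQ_subseq_LIMSEQ[OF rq_tendsto[OF p], of "\<lambda>n. Suc n + Suc n"]
    by (simp add: strict_mono_def o_def)
  then have "?l \<longlonglongrightarrow> ?P * (qpoch_inf z p * qpoch_inf w p)"
    by (intro tendsto_mult LIMSEQ_Suc[OF qpoch_tendsto[OF p]])
  ultimately have "((\<Sum>r. ?u r) + (\<Sum>r. ?v r)) * ?P ^ 2 = ?P * (qpoch_inf z p * qpoch_inf w p)"
    unfolding eq distrib_right by (rule LIMSEQ_unique)
  moreover have "S = R * y" if "S * inverse y ^ 2 = inverse y * R" "y \<noteq> 0" for S R y :: complex
    using that by (simp add: field_simps power2_eq_square)
  ultimately show "(\<Sum>r. ?u r) + (\<Sum>r. ?v r) = qpoch_inf z p * qpoch_inf w p * qpoch_inf p p"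
    using qpoch_inf_nonzero'[OF p p] by blast
qed

subsection \<open>Bailey's lemma and the Rogers--Ramanujan identities\<close>

text \<open>Bailey's lemma with both free parameters sent to infinity, relative to
  \<open>p ^ e\<close> up to normalisation. After \<open>s = r + t\<close> the inner sum is
  \<open>q_Vandermonde\<close> with \<open>c = 2 * r + e\<close>.\<close>

lemma Bailey_step:
  assumes "norm p < 1"
  shows "(\<Sum>s\<le>N. p ^ (s * s + e * s) * rq p (N - s) * (\<Sum>r\<le>s. a r * rq p (s - r) * rq p (s + r + e)))
    = (\<Sum>r\<le>N. p ^ (r * r + e * r) * a r * rq p (N - r) * rq p (N + r + e))"
proof -
  let ?g = "\<lambda>s r. p ^ (s * s + e * s) * rq p (N - s) * (a r * rq p (s - r) * rq p (s + r + e))"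
  have "(\<Sum>s\<le>N. p ^ (s * s + e * s) * rq p (N - s) * (\<Sum>r\<le>s. a r * rq p (s - r) * rq p (s + r + e)))
    = (\<Sum>s\<le>N. \<Sum>r\<le>s. ?g s r)"
    by (simp only: sum_distrib_left)
  also have "\<dots> = (\<Sum>r\<le>N. \<Sum>t\<le>N - r. ?g (r + t) r)"
    unfolding sum.Sigma[OF finite_atMost ballI[OF finite_atMost]]
    by (rule sum.reindex_bij_witness[of _ "\<lambda>(r, t). (r + t, r)" "\<lambda>(s, r). (r, s - r)"]) auto
  also have "\<dots> = (\<Sum>r\<le>N. p ^ (r * r + e * r) * a r * rq p (N - r) * rq p (N + r + e))"
  proof (rule sum.cong)
    fix r assume "r \<in> {..N}"
    then have r: "N - r + (2 * r + e) = N + r + e" by auto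
    have "?g (r + t) r = p ^ (r * r + e * r) * a r
        * (p ^ (t * (t + (2 * r + e))) * rq p (t + (2 * r + e)) * rq p t * rq p (N - r - t))" for t
    proof -
      have "(r + t) * (r + t) + e * (r + t) = r * r + e * r + t * (t + (2 * r + e))"
        by (simp add: algebra_simps)
      moreover have "r + t + r + e = t + (2 * r + e)" "N - (r + t) = N - r - t" "r + t - r = t"
        by auto
      ultimately show ?thesis
        by (simp only: power_add mult_ac)
    qed
    then show "(\<Sum>t\<le>N - r. ?g (r + t) r) = p ^ (r * r + e * r) * a r * rq p (N - r) * rq p (N + r + e)"
      by (simp only: sum_distrib_left[symmetric] q_Vandermonde[OF assms] r) (simp only: mult.assoc)
  qed simp
  finally show ?thesis .
qed

lemma norm_power_le_power:
  fixes p :: complex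
  assumes "norm p < 1" "k \<le> n"
  shows "norm (p ^ n) \<le> norm p ^ k"
  unfolding norm_power using assms by (intro power_decreasing) auto

text \<open>Two passes of \<open>Bailey_step\<close> from a unit pair, each contributing
  \<open>p ^ (r * r + e * r)\<close>, and then \<open>N\<close> to infinity.\<close>

lemma Bailey_limit:
  assumes p: "norm p < 1" and C: "\<And>r. norm (a r) \<le> C"
    and unit: "\<And>n. (\<Sum>r\<le>n. a r * rq p (n - r) * rq p (n + r + e)) = (if n = 0 then 1 else 0)"
  shows "(\<lambda>s. p ^ (s * s + e * s) * rq p s) sums
    ((\<Sum>r. p ^ (2 * (r * r + e * r)) * a r) / qpoch_inf p p)"
proof -
  obtain K where K: "K > 0" "\<And>n. norm (rq p n) \<le> K"
    using rq_bounded[OF p] by blast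
  let ?b = "\<lambda>s. p ^ (s * s + e * s) * rq p s" and ?c = "\<lambda>r. p ^ (2 * (r * r + e * r)) * a r"
  let ?P = "inverse (qpoch_inf p p)"
  have le: "s \<le> s * s + e * s" for s
    by (cases s) auto
  have b: "norm (?b s) \<le> norm p ^ s * K" for s
    unfolding norm_mult by (intro mult_mono norm_power_le_power p le K) auto
  have c: "norm (?c r) \<le> norm p ^ r * C" for r
    unfolding norm_mult using le[of r] by (intro mult_mono norm_power_le_power p C) auto
  have s: "summable (\<lambda>r. norm p ^ r * C)" for C
    using p by (intro summable_mult2 summable_geometric) auto
  \<comment> \<open>First pass: the unit pair leaves only the term \<open>s = 0\<close>.\<close>
  have step1: "(\<Sum>r\<le>N. p ^ (r * r + e * r) * a r * rq p (N - r) * rq p (N + r + e)) = rq p N" for N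
  proof -
    have "(\<Sum>s\<le>N. p ^ (s * s + e * s) * rq p (N - s) * (if s = 0 then 1 else 0)) = rq p N"
      by (subst sum.remove[of _ 0]) auto
    then show ?thesis
      using Bailey_step[OF p, of e N a] by (simp only: unit)
  qed
  have double: "p ^ (2 * k) = p ^ k * p ^ k" for k
    by (simp add: mult_2 power_add)
  \<comment> \<open>Second pass, applied to the coefficients produced by the first.\<close>
  have "(\<Sum>s\<le>N. ?b s * rq p (N - s)) = (\<Sum>r\<le>N. ?c r * rq p (N - r) * rq p (N + r + e))" for N
    using Bailey_step[OF p, of e N "\<lambda>r. p ^ (r * r + e * r) * a r"]
    unfolding step1 by (simp only: double mult_ac)
  then have "(\<Sum>s. ?b s) * ?P = (\<Sum>r. ?c r) * ?P ^ 2"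
    using suminf_mult_rq_tendsto(1)[OF p b s] suminf_mult_rq_tendsto(2)[OF p c s, of e]
    by (simp only: LIMSEQ_unique)
  then have "(\<Sum>s. ?b s) = (\<Sum>r. ?c r) / qpoch_inf p p"
    using qpoch_inf_nonzero'[OF p p] by (simp add: field_simps power2_eq_square)
  moreover have "summable ?b"
    by (rule summable_comparison_test'[OF s b])
  ultimately show ?thesis
    by (simp add: sums_iff)
qed

text \<open>
  The partial sums of the two unit Bailey pairs telescope; at \<open>R = n\<close> the factor \<open>1 - p ^ (n - R)\<close> vanishes.
\<close>

lemma unit_Bailey_pair_0_partial:
  assumes "norm p < 1" "R \<le> n"
  defines "a \<equiv> \<lambda>r. (- 1) ^ r * (p ^ (r choose 2) + (if r = 0 then 0 else p ^ (Suc r choose 2)))"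
  shows "(1 - p ^ n) * (\<Sum>r\<le>R. a r * rq p (n - r) * rq p (n + r))
    = (- 1) ^ R * p ^ (Suc R choose 2) * ((1 - p ^ (n - R)) * rq p (n - R)) * rq p (n + R)"
  using assms(2)
proof (induction R)
  case 0
  show ?case by (simp add: a_def numeral_2_eq_2)
next
  case (Suc R)
  then obtain d where n: "n = Suc (R + d)"
    using le_Suc_ex[of "Suc R" n] by auto
  \<comment> \<open>\<open>x\<close> and \<open>y\<close> bring both summands to the common factor
    \<open>rq p d * rq p (n + Suc R)\<close>.\<close>
  have x: "(1 - p ^ (n - R)) * rq p (n - R) = rq p d"
    using rq_Suc[OF assms(1), of d] by (simp add: n)
  have y: "rq p (n + R) = (1 - p ^ Suc (n + R)) * rq p (n + Suc R)"
    using rq_Suc[OF assms(1), of "n + R"] by (simp only: add_Suc_right)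
  have d: "n - Suc R = d" by (simp add: n)
  have "(1 - p ^ n) * (\<Sum>r\<le>Suc R. a r * rq p (n - r) * rq p (n + r))
    = (- 1) ^ R * p ^ (Suc R choose 2) * rq p d * ((1 - p ^ Suc (n + R)) * rq p (n + Suc R))
      + (1 - p ^ n) * (a (Suc R) * rq p d * rq p (n + Suc R))"
    by (simp only: sum.atMost_Suc distrib_left Suc.IH[OF Suc_leD[OF Suc.prems]] x d y[symmetric])
  also have "\<dots> = (- 1) ^ Suc R * p ^ (Suc (Suc R) choose 2) * ((1 - p ^ d) * rq p d) * rq p (n + Suc R)"
    by (simp add: a_def n numeral_2_eq_2 power_add algebra_simps)
  finally show ?case by (simp only: d)
qed

lemma unit_Bailey_pair_1_partial:
  assumes "norm p < 1" "R \<le> n"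
  defines "a \<equiv> \<lambda>r. (- 1) ^ r * (p ^ (r choose 2) * (1 - p ^ (2 * r + 1)))"
  shows "(1 - p ^ n) * (\<Sum>r\<le>R. a r * rq p (n - r) * rq p (n + r + 1))
    = (- 1) ^ R * p ^ (Suc R choose 2) * (1 - p ^ Suc R) * ((1 - p ^ (n - R)) * rq p (n - R)) * rq p (n + R + 1)"
  using assms(2)
proof (induction R)
  case 0
  show ?case by (simp add: a_def numeral_2_eq_2)
next
  case (Suc R)
  then obtain d where n: "n = Suc (R + d)"
    using le_Suc_ex[of "Suc R" n] by auto
  have x: "(1 - p ^ (n - R)) * rq p (n - R) = rq p d"
    using rq_Suc[OF assms(1), of d] by (simp add: n)
  have y: "rq p (n + R + 1) = (1 - p ^ Suc (n + R + 1)) * rq p (n + Suc R + 1)"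
    using rq_Suc[OF assms(1), of "n + R + 1"] by (simp only: add_Suc_right add_Suc)
  have d: "n - Suc R = d" by (simp add: n)
  have "(1 - p ^ n) * (\<Sum>r\<le>Suc R. a r * rq p (n - r) * rq p (n + r + 1))
    = (- 1) ^ R * p ^ (Suc R choose 2) * (1 - p ^ Suc R) * rq p d * ((1 - p ^ Suc (n + R + 1)) * rq p (n + Suc R + 1))
      + (1 - p ^ n) * (a (Suc R) * rq p d * rq p (n + Suc R + 1))"
    by (simp only: sum.atMost_Suc distrib_left Suc.IH[OF Suc_leD[OF Suc.prems]] x d y[symmetric])
  also have "\<dots> = (- 1) ^ Suc R * p ^ (Suc (Suc R) choose 2) * (1 - p ^ Suc (Suc R)) * ((1 - p ^ d) * rq p d) * rq p (n + Suc R + 1)"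
    by (simp add: a_def n numeral_2_eq_2 power_add algebra_simps)
  finally show ?case by (simp only: d)
qed

text \<open>For \<open>r > 0\<close> the two powers belong to the indices \<open>r\<close> and
  \<open>- r\<close> of \<open>(- 1) ^ j * p ^ (j (j - 1) / 2)\<close>; index 0 occurs once, hence
  the \<open>if\<close>.\<close>

lemma unit_Bailey_pair_0:
  assumes "norm p < 1"
  shows "(\<Sum>r\<le>n. (- 1) ^ r * (p ^ (r choose 2) + (if r = 0 then 0 else p ^ (Suc r choose 2))) * rq p (n - r) * rq p (n + r + 0))
    = (if n = 0 then 1 else 0)"
proof (cases "n = 0")
  case False
  then show ?thesis
    using unit_Bailey_pair_0_partial[OF assms order_refl, of n] one_minus_power_nonzero[OF assms, of n]
    by auto
qed (simp add: numeral_2_eq_2)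

text \<open>The pair relative to \<open>p\<close>: its usual denominator \<open>1 - p\<close> is
  absorbed by the shifted index \<open>n + r + 1\<close>.\<close>

lemma unit_Bailey_pair_1:
  assumes "norm p < 1"
  shows "(\<Sum>r\<le>n. (- 1) ^ r * (p ^ (r choose 2) * (1 - p ^ (2 * r + 1))) * rq p (n - r) * rq p (n + r + 1))
    = (if n = 0 then 1 else 0)"
proof (cases "n = 0")
  case False
  then show ?thesis
    using unit_Bailey_pair_1_partial[OF assms order_refl, of n] one_minus_power_nonzero[OF assms, of n]
    by auto
qed (use rq_Suc[OF assms, of 0] in \<open>simp add: numeral_2_eq_2\<close>)

section \<open>Exponent arithmetic for the Rogers--Ramanujan theta series\<close>

lemma two_choose_two: "2 * (n choose 2) + n = n * n"
  by (induction n) (simp_all add: numeral_2_eq_2)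

lemma Suc_choose_two: "Suc n choose 2 = n + (n choose 2)"
  by (simp add: numeral_2_eq_2)

lemma minus_power_power:
  fixes q :: complex
  shows "(- (q ^ i)) ^ r * (q ^ j) ^ n = (- 1) ^ r * (q ^ (i * r) * q ^ (j * n))"
  by (simp add: power_mult power_minus[of "q ^ i"])

lemma norm_power_less_1:
  fixes q :: complex
  assumes "norm q < 1" "n > 0"
  shows "norm (q ^ n) < 1"
  using assms by (simp add: norm_power power_less_one_iff)

text \<open>\<open>Bailey_limit\<close> with \<open>e = 0\<close> yields the triple product for
  \<open>z = q ^ 2\<close>, \<open>w = q ^ 3\<close>, base \<open>q ^ 5\<close>; dividing by the
  dissected \<open>qpoch_inf q q\<close> leaves the residues 1 and 4.\<close>

theorem Rogers_Ramanujan_1: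
  assumes q: "norm q < 1"
  shows "(\<lambda>s. q ^ (s * s) * rq q s) sums inverse (qpochs_inf [q, q ^ 4] (q ^ 5))"
proof -
  let ?a = "\<lambda>r. (- 1) ^ r * (q ^ (r choose 2) + (if r = 0 then 0 else q ^ (Suc r choose 2)))"
  let ?u = "\<lambda>r. (- (q ^ 2)) ^ r * (q ^ 5) ^ (r choose 2)"
  let ?v = "\<lambda>r. (- (q ^ 3)) ^ Suc r * (q ^ 5) ^ (Suc r choose 2)"
  \<comment> \<open>The second power in \<open>?a\<close> starts at \<open>r = 1\<close>, so
    \<open>?v\<close> is delayed by one place and padded with 0.\<close>
  let ?w = "\<lambda>r. if r = 0 then 0 else ?v (r - 1)"
  have le1: "norm (q ^ n) \<le> 1" for n
    using norm_power_le_power[OF q le0] by simp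
  have "norm (?a r) \<le> 1 + 1" for r
  proof -
    have "norm (?a r) = norm (q ^ (r choose 2) + (if r = 0 then 0 else q ^ (Suc r choose 2)))"
      by (simp only: norm_mult norm_power[of "- 1"] norm_minus_cancel norm_one power_one mult_1)
    also have "\<dots> \<le> 1 + 1"
      using le1 by (intro norm_triangle_mono) auto
    finally show ?thesis .
  qed
  then have *: "(\<lambda>s. q ^ (s * s + 0 * s) * rq q s) sums
    ((\<Sum>r. q ^ (2 * (r * r + 0 * r)) * ?a r) / qpoch_inf q q)"
    by (rule Bailey_limit[OF q _ unit_Bailey_pair_0[OF q]])
  have "q ^ (2 * (r * r + 0 * r)) * ?a r = ?u r + ?w r" for r
  proof -
    have "2 * (r * r) + (r choose 2) = 2 * r + 5 * (r choose 2)"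
      using two_choose_two[of r] by linarith
    then have "q ^ (2 * (r * r)) * q ^ (r choose 2) = q ^ (2 * r) * q ^ (5 * (r choose 2))"
      by (simp only: flip: power_add)
    moreover have "2 * (r * r) + (Suc r choose 2) = 3 * r + 5 * (r choose 2)"
      using two_choose_two[of r] unfolding Suc_choose_two by linarith
    then have "q ^ (2 * (r * r)) * q ^ (Suc r choose 2) = q ^ (3 * r) * q ^ (5 * (r choose 2))"
      by (simp only: flip: power_add)
    moreover have "?w r = (if r = 0 then 0 else (- (q ^ 3)) ^ r * (q ^ 5) ^ (r choose 2))"
      by (cases r) auto
    ultimately show ?thesis
      unfolding minus_power_power by (cases "r = 0") (auto simp: distrib_left mult.left_commute)
  qed
  moreover have "q ^ 2 * q ^ 3 = q ^ 5"
    by (simp flip: power_add)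
  note jtp = Jacobi_triple_product[OF norm_power_less_1[OF q] norm_power_less_1[OF q] this, simplified]
  have "(\<lambda>r. ?u r + ?w r) sums ((\<Sum>r. ?u r) + (\<Sum>r. ?v r))"
  proof (intro sums_add summable_sums)
    show "?w sums (\<Sum>r. ?v r)"
      using sums_Suc_iff[of ?w "\<Sum>r. ?v r"] jtp(2) by (simp add: sums_iff)
  qed (use jtp(1) in simp)
  ultimately have "(\<Sum>r. q ^ (2 * (r * r + 0 * r)) * ?a r) = (\<Sum>r. ?u r) + (\<Sum>r. ?v r)"
    by (simp only: sums_iff)
  then show ?thesis
    using * jtp(3) qpoch_inf_nonzero'[OF norm_power_less_1[OF q] norm_power_less_1[OF q], of 5 _]
    unfolding qpoch_inf_dissect[OF q] qpochs_inf_def by (simp add: field_simps)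
qed

text \<open>Same route with \<open>e = 1\<close>, \<open>z = q ^ 4\<close> and \<open>w = q\<close>,
  leaving the residues 2 and 3.\<close>

theorem Rogers_Ramanujan_2:
  assumes q: "norm q < 1"
  shows "(\<lambda>s. q ^ (s * s + s) * rq q s) sums inverse (qpochs_inf [q ^ 2, q ^ 3] (q ^ 5))"
proof -
  let ?a = "\<lambda>r. (- 1) ^ r * (q ^ (r choose 2) * (1 - q ^ (2 * r + 1)))"
  let ?u = "\<lambda>r. (- (q ^ 4)) ^ r * (q ^ 5) ^ (r choose 2)"
  \<comment> \<open>\<open>q ^ 1\<close> stays a power so that \<open>minus_power_power\<close> and
    \<open>norm_power_less_1\<close> match it.\<close>
  let ?v = "\<lambda>r. (- (q ^ 1)) ^ Suc r * (q ^ 5) ^ (Suc r choose 2)"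
  have le1: "norm (q ^ n) \<le> 1" for n
    using norm_power_le_power[OF q le0] by simp
  have "norm (?a r) \<le> 1 * (1 + 1)" for r
  proof -
    have "norm (?a r) = norm (q ^ (r choose 2)) * norm (1 - q ^ (2 * r + 1))"
      by (simp only: norm_mult norm_power[of "- 1"] norm_minus_cancel norm_one power_one mult_1)
    also have "\<dots> \<le> 1 * (1 + 1)"
      by (intro mult_mono order_trans[OF norm_triangle_ineq4] add_mono le1) auto
    finally show ?thesis .
  qed
  then have *: "(\<lambda>s. q ^ (s * s + 1 * s) * rq q s) sums
    ((\<Sum>r. q ^ (2 * (r * r + 1 * r)) * ?a r) / qpoch_inf q q)"
    by (rule Bailey_limit[OF q _ unit_Bailey_pair_1[OF q]])
  have "q ^ (2 * (r * r + 1 * r)) * ?a r = ?u r + ?v r" for r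
  proof -
    have "2 * (r * r + 1 * r) + (r choose 2) = 4 * r + 5 * (r choose 2)"
      unfolding two_choose_two[symmetric] by simp
    then have "q ^ (2 * (r * r + 1 * r)) * q ^ (r choose 2) = q ^ (4 * r) * q ^ (5 * (r choose 2))"
      by (simp only: flip: power_add)
    \<comment> \<open>The \<open>- q ^ (2 * r + 1)\<close> half of the coefficient is the triple
      product term of index \<open>- Suc r\<close>, already aligned with \<open>?v\<close>.\<close>
    moreover have "2 * (r * r + 1 * r) + (r choose 2) + (2 * r + 1) = 1 * Suc r + 5 * (Suc r choose 2)"
      unfolding two_choose_two[symmetric] Suc_choose_two by simp
    then have "q ^ (2 * (r * r + 1 * r)) * q ^ (r choose 2) * q ^ (2 * r + 1) = q ^ (1 * Suc r) * q ^ (5 * (Suc r choose 2))"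
      by (simp only: flip: power_add)
    moreover have "q ^ (2 * (r * r + 1 * r)) * ?a r = (- 1) ^ r * (q ^ (2 * (r * r + 1 * r)) * q ^ (r choose 2))
      + (- 1) ^ Suc r * (q ^ (2 * (r * r + 1 * r)) * q ^ (r choose 2) * q ^ (2 * r + 1))"
      by (simp add: algebra_simps)
    ultimately show ?thesis
      unfolding minus_power_power by (simp only:)
  qed
  moreover have "q ^ 4 * q ^ 1 = q ^ 5"
    by (simp flip: power_Suc2)
  note jtp = Jacobi_triple_product[OF norm_power_less_1[OF q] norm_power_less_1[OF q] this, simplified]
  have "(\<lambda>r. ?u r + ?v r) sums ((\<Sum>r. ?u r) + (\<Sum>r. ?v r))"
    using jtp(1,2) by (intro sums_add summable_sums) simp_all
  ultimately have "(\<Sum>r. q ^ (2 * (r * r + 1 * r)) * ?a r) = (\<Sum>r. ?u r) + (\<Sum>r. ?v r)"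
    by (simp only: sums_iff)
  then show ?thesis
    using * jtp(3) qpoch_inf_nonzero'[OF norm_power_less_1[OF q] norm_power_less_1[OF q], of 5 _]
      qpoch_inf_nonzero'[OF norm_power_less_1[OF q] q, of 5]
    unfolding qpoch_inf_dissect[OF q] qpochs_inf_def by (simp add: field_simps)
qed

subsection \<open>Reduction of the series to the Rogers--Ramanujan series\<close>

text \<open>Geometric domination makes the double family absolutely summable, so rows and diagonals
  give the same value, which uniqueness identifies with \<open>T\<close>.\<close>

lemma sums_diagonal:
  fixes F :: "nat \<Rightarrow> nat \<Rightarrow> complex"
  assumes x: "0 \<le> x" "x < 1" and F: "\<And>n k. norm (F n k) \<le> C * x ^ n * x ^ k" and C: "C \<ge> 0"
    and R: "\<And>n. (F n) sums R n" and T: "(\<lambda>N. \<Sum>k\<le>N. F (N - k) k) sums T"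
  shows "R sums T"
proof -
  have geo: "((\<lambda>k. c * x ^ k) has_sum (c * (1 / (1 - x)))) UNIV" if "c \<ge> 0" for c
    using x that by (intro sums_nonneg_imp_has_sum sums_mult geometric_sums) auto
  have "(\<lambda>(n, k). C * x ^ n * x ^ k) summable_on UNIV \<times> UNIV"
  proof (rule summable_on_SigmaI)
    show "((\<lambda>k. case (n, k) of (n, k) \<Rightarrow> C * x ^ n * x ^ k) has_sum (C * x ^ n * (1 / (1 - x)))) UNIV" for n
      using geo[of "C * x ^ n"] x C by simp
    have "((\<lambda>n. C * x ^ n * (1 / (1 - x))) has_sum (C * (1 / (1 - x)) * (1 / (1 - x)))) UNIV"
      using geo[OF C] by (rule has_sum_cmult_left)
    then show "(\<lambda>n. C * x ^ n * (1 / (1 - x))) summable_on UNIV"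
      by (rule has_sum_imp_summable)
  qed (use x C in auto)
  then have "(\<lambda>z. norm (case z of (n, k) \<Rightarrow> F n k)) summable_on UNIV \<times> UNIV"
    by (rule Infinite_Sum.abs_summable_on_comparison_test') (use F in auto)
  then have "(\<lambda>(n, k). F n k) summable_on UNIV \<times> UNIV"
    by (rule abs_summable_summable)
  then obtain S where S: "((\<lambda>(n, k). F n k) has_sum S) (UNIV \<times> UNIV)"
    by (auto simp: summable_on_def)
  have nF: "summable (\<lambda>k. norm (F n k))" for n
    by (rule summable_comparison_test'[of "\<lambda>k. C * x ^ n * x ^ k" 0])
      (use F x in \<open>auto intro!: summable_mult summable_geometric\<close>)
  have "(R has_sum S) UNIV"
    by (rule has_sum_SigmaD[OF S]) (use nF R in \<open>auto intro: norm_summable_imp_has_sum\<close>)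
  then have RS: "R sums S"
    by (rule has_sum_imp_sums)
  have "((\<lambda>(N, k). F (N - k) k) has_sum S) (Sigma UNIV (\<lambda>N. {..N}))"
    by (rule iffD1[OF has_sum_reindex_bij_witness[of _ "\<lambda>(N, k). (N - k, k)" "\<lambda>(n, k). (n + k, k)"] S]) auto
  then have "((\<lambda>N. \<Sum>k\<le>N. F (N - k) k) has_sum S) UNIV"
    by (rule has_sum_SigmaD) (auto intro: has_sum_finite)
  then have "(\<lambda>N. \<Sum>k\<le>N. F (N - k) k) sums S"
    by (rule has_sum_imp_sums)
  with T have "S = T"
    using sums_unique2 by blast
  with RS show ?thesis by simp
qed

text \<open>\<open>r N\<close> is the Rogers--Szego polynomial divided by the q-factorial. Pascal's
  rule leaves the weight \<open>p ^ k = 1 - (1 - p ^ k)\<close>, whose second part lowers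
  \<open>k\<close> and yields \<open>x * r M\<close>.\<close>

lemma Rogers_Szego_recurrence:
  fixes x :: complex
  assumes "norm p < 1"
  defines "r \<equiv> \<lambda>N. \<Sum>k\<le>N. x ^ k * rq p k * rq p (N - k)"
  shows "(1 - p ^ Suc (Suc M)) * r (Suc (Suc M)) = (1 + x) * r (Suc M) - x * r M"
proof -
  have "(\<Sum>k\<le>Suc M. (1 - p ^ k) * (x ^ k * rq p k * rq p (Suc M - k)))
    = (\<Sum>k\<le>M. x ^ Suc k * ((1 - p ^ Suc k) * rq p (Suc k)) * rq p (M - k))"
    by (subst sum.atMost_Suc_shift) (simp add: mult_ac)
  also have "\<dots> = x * r M"
    unfolding rq_Suc[OF assms(1)] by (simp add: r_def sum_distrib_left mult_ac)
  finally have "(\<Sum>k\<le>Suc M. p ^ k * (x ^ k * rq p k * rq p (Suc M - k))) = r (Suc M) - x * r M"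
    by (simp only: left_diff_distrib sum_subtractf mult_1 r_def) (simp only: diff_eq_eq eq_diff_eq add.commute)
  moreover have "(1 - p ^ Suc (Suc M)) * r (Suc (Suc M))
    = x * r (Suc M) + (\<Sum>k\<le>Suc M. p ^ k * (x ^ k * rq p k * rq p (Suc M - k)))"
    unfolding r_def rq_pascal[OF assms(1)]
    by (simp only: distrib_right sum.distrib sum_distrib_left power_Suc mult.assoc)
  ultimately show ?thesis by (simp only:) (simp add: algebra_simps)
qed

text \<open>Behind this is the splitting of the generating function of \<open>rq q\<close> into even
  and odd exponents; the proof checks that \<open>rq q\<close> solves the Rogers--Szego recurrence
  at \<open>x = q\<close>, base \<open>q ^ 2\<close>.\<close>

lemma rq_square_convolution:
  assumes q: "norm q < 1"
  shows "(\<Sum>k\<le>N. q ^ k * rq (q ^ 2) k * rq (q ^ 2) (N - k)) = rq q N"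
proof (induction N rule: induct_nat_012)
  case 0
  show ?case by simp
next
  case 1
  have nz: "1 - q \<noteq> 0" "1 - q ^ 2 \<noteq> 0"
    using one_minus_power_nonzero[OF q, of 1] one_minus_power_nonzero[OF q, of 2] by auto
  have "1 - q ^ 2 = (1 - q) * (1 + q)"
    by (simp add: algebra_simps power2_eq_square)
  with nz have "(1 + q) / (1 - q ^ 2) = 1 / (1 - q)"
    by (simp add: field_simps)
  then show ?case
    by (simp add: rq_def qpoch_def inverse_eq_divide flip: add_divide_distrib)
next
  case (ge2 M)
  have q2: "norm (q ^ 2) < 1"
    using norm_power_less_1[OF q] by simp
  let ?r = "\<lambda>N. \<Sum>k\<le>N. q ^ k * rq (q ^ 2) k * rq (q ^ 2) (N - k)"
  have "(1 - (q ^ 2) ^ Suc (Suc M)) * ?r (Suc (Suc M)) = (1 + q) * rq q (Suc M) - q * rq q M"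
    unfolding Rogers_Szego_recurrence[OF q2] ge2 ..
  also have "rq q M = (1 - q ^ Suc M) * rq q (Suc M)"
    by (rule rq_Suc[OF q, symmetric])
  also have "(1 + q) * rq q (Suc M) - q * ((1 - q ^ Suc M) * rq q (Suc M)) = (1 + q ^ Suc (Suc M)) * rq q (Suc M)"
    by (simp add: algebra_simps)
  also have "rq q (Suc M) = (1 - q ^ Suc (Suc M)) * rq q (Suc (Suc M))"
    by (rule rq_Suc[OF q, symmetric])
  also have "(1 + q ^ Suc (Suc M)) * ((1 - q ^ Suc (Suc M)) * rq q (Suc (Suc M)))
    = (1 - (q ^ 2) ^ Suc (Suc M)) * rq q (Suc (Suc M))"
    by (simp add: algebra_simps power2_eq_square power_mult_distrib)
  finally show ?case
    using one_minus_power_nonzero[OF q2, of "Suc (Suc M)"] mult_cancel_left by blast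
qed

lemma qpoch_power4: "qpoch (q ^ 4) (q ^ 4) n = qpoch (q ^ 2) (q ^ 2) n * qpoch (- (q ^ 2)) (q ^ 2) n"
proof -
  have "1 - q ^ 4 * (q ^ 4) ^ k = (1 - q ^ 2 * (q ^ 2) ^ k) * (1 - - (q ^ 2) * (q ^ 2) ^ k)" for k
  proof -
    have "q ^ 4 * (q ^ 4) ^ k = (q ^ 2 * (q ^ 2) ^ k) ^ 2"
      by (simp add: power_mult_distrib mult.commute flip: power_mult)
    then show ?thesis
      by (simp only:) (simp add: algebra_simps power2_eq_square)
  qed
  then show ?thesis
    by (simp only: qpoch_def prod.distrib)
qed

text \<open>On the diagonal \<open>n + k = N\<close> the exponent in \<open>?F\<close> exceeds
  \<open>N * N + e * N\<close> by \<open>k\<close> for \<open>e = 0\<close> and by \<open>n\<close>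
  for \<open>e = 1\<close>, so \<open>rq_square_convolution\<close> sums it in both cases.\<close>

lemma Slater_sum_transform:
  assumes q: "norm q < 1" and e: "e = 0 \<or> e = 1"
    and T: "(\<lambda>N. q ^ (N * N + e * N) * rq q N) sums T"
  shows "(\<lambda>n. q ^ (n ^ 2 + 2 * e * n) / qpoch (q ^ 4) (q ^ 4) n) sums (T / qpoch_inf (- (q ^ 2)) (q ^ 2))"
proof -
  let ?p = "q ^ 2" and ?D = "qpoch_inf (- (q ^ 2)) (q ^ 2)"
  have p: "norm ?p < 1"
    using norm_power_less_1[OF q] by simp
  have D: "?D \<noteq> 0"
    using p by (intro qpoch_inf_nonzero') auto
  obtain K where K: "K > 0" "\<And>n. norm (rq ?p n) \<le> K"
    using rq_bounded[OF p] by blast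
  let ?F = "\<lambda>n k. q ^ ((n + k) * (n + k) + 2 * e * n + k) * rq ?p n * rq ?p k"
  let ?R = "\<lambda>n. ?D * (q ^ (n ^ 2 + 2 * e * n) / qpoch (q ^ 4) (q ^ 4) n)"
  have "?R sums T"
  proof (rule sums_diagonal[where x = "norm q" and C = "K * K" and F = ?F])
    show "norm (?F n k) \<le> K * K * norm q ^ n * norm q ^ k" for n k
    proof -
      have "n + k \<le> (n + k) * (n + k) + 2 * e * n + k"
        by (cases "n + k") auto
      from norm_power_le_power[OF q this]
      have "norm (?F n k) \<le> norm q ^ (n + k) * K * K"
        unfolding norm_mult using K(1) by (intro mult_mono K) auto
      then show ?thesis by (simp add: power_add mult_ac)
    qed
    show "?F n sums ?R n" for n
    proof -
      have "- ?p * ?p ^ n = - (q ^ (2 + 2 * n))"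
        by (simp only: power_add power_mult mult_minus_left)
      then have "norm (- ?p * ?p ^ n) < 1"
        using norm_power_less_1[OF q, of "2 + 2 * n"] by (simp only: norm_minus_cancel)
      from sums_mult[OF Euler_qpoch_inf_sums[OF p this], of "q ^ (n ^ 2 + 2 * e * n) * rq ?p n"]
      have "(\<lambda>k. q ^ (n ^ 2 + 2 * e * n) * rq ?p n * ((- (- ?p * ?p ^ n)) ^ k * ?p ^ (k choose 2) * rq ?p k))
        sums (q ^ (n ^ 2 + 2 * e * n) * rq ?p n * qpoch_inf (- ?p * ?p ^ n) ?p)" .
      also have "(\<lambda>k. q ^ (n ^ 2 + 2 * e * n) * rq ?p n * ((- (- ?p * ?p ^ n)) ^ k * ?p ^ (k choose 2) * rq ?p k)) = ?F n"
      proof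
        fix k
        have "(n + k) * (n + k) + 2 * e * n + k = n ^ 2 + 2 * e * n + ((2 + 2 * n) * k + 2 * (k choose 2))"
          using two_choose_two[of k] by (simp add: power2_eq_square algebra_simps)
        moreover have "(- (- ?p * ?p ^ n)) ^ k * ?p ^ (k choose 2) = q ^ ((2 + 2 * n) * k + 2 * (k choose 2))"
          by (simp add: power_add power_mult power_mult_distrib)
        ultimately show "q ^ (n ^ 2 + 2 * e * n) * rq ?p n * ((- (- ?p * ?p ^ n)) ^ k * ?p ^ (k choose 2) * rq ?p k) = ?F n k"
          by (simp only: power_add mult_ac)
      qed
      also have "q ^ (n ^ 2 + 2 * e * n) * rq ?p n * qpoch_inf (- ?p * ?p ^ n) ?p = ?R n"
      proof -
        \<comment> \<open>The finite product is a factor of the nonzero \<open>?D\<close>, so it may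
          be cancelled.\<close>
        have "qpoch (- ?p) ?p n \<noteq> 0"
          using D unfolding qpoch_inf_split[OF p, of "- ?p" n] by auto
        then show ?thesis
          using qpoch_self_nonzero[OF p, of n] unfolding qpoch_inf_split[OF p, of "- ?p" n] qpoch_power4 rq_def
          by (simp add: field_simps)
      qed
      finally show ?thesis .
    qed
    have "(\<Sum>k\<le>N. ?F (N - k) k) = q ^ (N * N + e * N) * rq q N" for N
      using e
    proof
      assume e: "e = 0"
      have "(\<Sum>k\<le>N. ?F (N - k) k) = (\<Sum>k\<le>N. q ^ (N * N) * (q ^ k * rq ?p k * rq ?p (N - k)))"
        by (rule sum.cong) (auto simp: e power_add mult_ac)
      then show ?thesis
        by (simp add: e rq_square_convolution[OF q] flip: sum_distrib_left)
    next
      assume e: "e = 1"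
      \<comment> \<open>The surplus exponent is now the first index, so the diagonal is
        reversed.\<close>
      have "(\<Sum>k\<le>N. ?F (N - k) k) = (\<Sum>k\<le>N. ?F k (N - k))"
        by (rule sum.reindex_bij_witness[of _ "\<lambda>k. N - k" "\<lambda>k. N - k"]) auto
      also have "\<dots> = (\<Sum>k\<le>N. q ^ (N * N + N) * (q ^ k * rq ?p k * rq ?p (N - k)))"
      proof (rule sum.cong)
        fix k assume "k \<in> {..N}"
        then have "(k + (N - k)) * (k + (N - k)) + 2 * e * k + (N - k) = N * N + N + k"
          by (auto simp: e)
        then show "?F k (N - k) = q ^ (N * N + N) * (q ^ k * rq ?p k * rq ?p (N - k))"
          by (simp only: power_add mult_ac)
      qed simp
      finally show ?thesis
        by (simp add: e rq_square_convolution[OF q] flip: sum_distrib_left)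
    qed
    then show "(\<lambda>N. \<Sum>k\<le>N. ?F (N - k) k) sums T"
      using T by (simp only:)
  qed (use q K in auto)
  from sums_divide[OF this, of ?D] show ?thesis
    using D by simp
qed

text \<open>Termwise, \<open>1 - q ^ (4 * n)\<close> cancels the last factor of the denominator, so
  the terms for \<open>m\<close> and \<open>m + 2\<close> differ by a multiple of the preceding term
  for \<open>m + 1\<close>.\<close>

lemma Slater_shift_recurrence:
  assumes q: "norm q < 1"
    and S0: "(\<lambda>n. q ^ (n ^ 2 + 2 * m * n) / qpoch (q ^ 4) (q ^ 4) n) sums S0"
    and S1: "(\<lambda>n. q ^ (n ^ 2 + 2 * Suc m * n) / qpoch (q ^ 4) (q ^ 4) n) sums S1"
  shows "(\<lambda>n. q ^ (n ^ 2 + 2 * Suc (Suc m) * n) / qpoch (q ^ 4) (q ^ 4) n) sums (S0 - q ^ (2 * m + 1) * S1)"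
proof -
  let ?t = "\<lambda>m n. q ^ (n ^ 2 + 2 * m * n) / qpoch (q ^ 4) (q ^ 4) n"
  \<comment> \<open>The value at \<open>n = 0\<close> is 0 because \<open>1 - q ^ (4 * n)\<close>
    vanishes there.\<close>
  let ?w = "\<lambda>n. if n = 0 then 0 else q ^ (2 * m + 1) * ?t (Suc m) (n - 1)"
  have q4: "norm (q ^ 4) < 1"
    using norm_power_less_1[OF q] by simp
  have "?w sums (q ^ (2 * m + 1) * S1)"
    using sums_Suc_iff[of ?w "q ^ (2 * m + 1) * S1"] sums_mult[OF S1, of "q ^ (2 * m + 1)"] by simp
  from sums_diff[OF S0 this] have "(\<lambda>n. ?t m n - ?w n) sums (S0 - q ^ (2 * m + 1) * S1)" .
  moreover have "?t m n - ?w n = ?t (Suc (Suc m)) n" for n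
  proof (cases n)
    case (Suc k)
    have "(2 * m + 1) + (k ^ 2 + 2 * Suc m * k) = Suc k ^ 2 + 2 * m * Suc k"
      by (simp add: power2_eq_square algebra_simps)
    then have "q ^ (2 * m + 1) * q ^ (k ^ 2 + 2 * Suc m * k) = q ^ (Suc k ^ 2 + 2 * m * Suc k)"
      by (simp only: flip: power_add)
    then have "?w n = q ^ (n ^ 2 + 2 * m * n) * (1 - (q ^ 4) ^ n) / qpoch (q ^ 4) (q ^ 4) n"
      using qpoch_self_nonzero[OF q4, of n] unfolding Suc by (simp add: qpoch_Suc field_simps)
    then have "?t m n - ?w n = q ^ (n ^ 2 + 2 * m * n) * (q ^ 4) ^ n / qpoch (q ^ 4) (q ^ 4) n"
      by (simp add: right_diff_distrib diff_divide_distrib)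
    also have "q ^ (n ^ 2 + 2 * m * n) * (q ^ 4) ^ n = q ^ (n ^ 2 + 2 * Suc (Suc m) * n)"
      by (simp add: algebra_simps flip: power_add power_mult)
    finally show ?thesis .
  qed simp
  ultimately show ?thesis by (simp only:)
qed

theorem theorem2p2:
  fixes q :: complex and A B :: "nat \<Rightarrow> complex" and m :: nat
  assumes "norm q < 1"
    and "A 0 = 1" and "A 1 = 0"
    and "\<And>k. k \<ge> 2 \<Longrightarrow> A k = - (q ^ (2 * k - 3)) * A (k - 1) + A (k - 2)"
    and "B 0 = 0" and "B 1 = 1"
    and "\<And>k. k \<ge> 2 \<Longrightarrow> B k = - (q ^ (2 * k - 3)) * B (k - 1) + B (k - 2)"
  shows "(\<lambda>n. q ^ (n ^ 2 + 2 * m * n) / qpoch (q ^ 4) (q ^ 4) n) sums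
    (A m / (qpochs_inf [q, q ^ 4] (q ^ 5) * qpoch_inf (- (q ^ 2)) (q ^ 2))
     + B m / (qpochs_inf [q ^ 2, q ^ 3] (q ^ 5) * qpoch_inf (- (q ^ 2)) (q ^ 2)))"
\<comment> \<open>Each pair of initial values selects one Rogers--Ramanujan product; the recurrences
  do the rest.\<close>
proof (induction m rule: induct_nat_012)
  case 0
  show ?case
    using Slater_sum_transform[OF assms(1), of 0] Rogers_Ramanujan_1[OF assms(1)]
    by (simp add: assms(2,5) divide_inverse)
next
  case 1
  show ?case
    using Slater_sum_transform[OF assms(1), of 1] Rogers_Ramanujan_2[OF assms(1)] assms(3,6)
    by (simp add: divide_inverse)
next
  case (ge2 k)
  \<comment> \<open>The natural subtraction does not truncate, since the minuend is at least
    4.\<close>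
  have "2 * Suc (Suc k) - 3 = 2 * k + 1" by simp
  then have AB: "A (Suc (Suc k)) = A k - q ^ (2 * k + 1) * A (Suc k)" "B (Suc (Suc k)) = B k - q ^ (2 * k + 1) * B (Suc k)"
    using assms(4)[of "Suc (Suc k)"] assms(7)[of "Suc (Suc k)"] by (simp_all only: diff_Suc_Suc) auto
  show ?case
    using Slater_shift_recurrence[OF assms(1) ge2]
    by (simp only: AB) (simp add: algebra_simps diff_divide_distrib)
qed

end
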